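(* The pseudovarieties $\langle\mathsf{Inv}\rangle\cap\mathsf{A}$ and $\mathsf{MN}\cap\mathsf{A}$ are incomparable, i.e. neither is contained in the other.
   Context: A pseudovariety of semigroups is a class of finite semigroups closed under subsemigroups, homomorphic images and finite direct products; $\langle\mathcal C\rangle$ is the pseudovariety generated by a class $\mathcal C$ of finite semigroups. $\mathsf{Inv}$ is the class of all finite inverse semigroups and $\mathsf A$ the pseudovariety of all finite aperiodic semigroups (all subgroups trivial). For a semigroup $S$, $S^1=S$ if $S$ has an identity element, and otherwise $S^1=S\cup\{1\}$ with an adjoined identity. For $x,y\in S$ and $z_1,z_2,\ldots\in S^1$ put $\lambda_0=x$, $\rho_0=y$, $\lambda_{n+1}=\lambda_n z_{n+1}\rho_n$, $\rho_{n+1}=\rho_n z_{n+1}\lambda_n$, with $\lambda_n=\lambda_n(x,y,z_1,\ldots,z_n)$, $\rho_n=\rho_n(x,y,z_1,\ldots,z_n)$. $\mathsf{MN}$ is the pseudovariety of finite (Mal'cev) nilpotent semigroups: finite $S$ for which there is $n\ge0$ with $\lambda_n(a,b,c_1,\ldots,c_n)=\rho_n(a,b,c_1,\ldots,c_n)$ for all $a,b\in S$, $c_1,\ldots,c_n\in S^1$. *)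

theory Defs
  imports "HOL-Algebra.Group"
begin

record 'a semigrp = "'a partial_object" +
  sprod :: "['a, 'a] \<Rightarrow> 'a" (infixl "\<cdot>\<index>" 70)

text \<open>Semigroups are nonempty. The product is only meaningful on the carrier.\<close>

locale semigrp =
  fixes S :: "('a, 'b) semigrp_scheme" (structure)
  assumes nonempty: "carrier S \<noteq> {}"
    and closed: "\<lbrakk>x \<in> carrier S; y \<in> carrier S\<rbrakk> \<Longrightarrow> x \<cdot> y \<in> carrier S"
    and assoc: "\<lbrakk>x \<in> carrier S; y \<in> carrier S; z \<in> carrier S\<rbrakk>
      \<Longrightarrow> (x \<cdot> y) \<cdot> z = x \<cdot> (y \<cdot> z)"

definition finite_semigrp :: "'a semigrp \<Rightarrow> bool" where
  "finite_semigrp S \<longleftrightarrow> semigrp S \<and> finite (carrier S)"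

definition subsemigrp :: "'a semigrp \<Rightarrow> 'a semigrp \<Rightarrow> bool" where
  "subsemigrp T S \<longleftrightarrow> semigrp T \<and> carrier T \<subseteq> carrier S \<and>
     (\<forall>x\<in>carrier T. \<forall>y\<in>carrier T. x \<cdot>\<^bsub>T\<^esub> y = x \<cdot>\<^bsub>S\<^esub> y)"

definition semigrp_hom :: "'a semigrp \<Rightarrow> 'b semigrp \<Rightarrow> ('a \<Rightarrow> 'b) set" where
  "semigrp_hom S T = {f. f \<in> carrier S \<rightarrow> carrier T \<and>
     (\<forall>x\<in>carrier S. \<forall>y\<in>carrier S. f (x \<cdot>\<^bsub>S\<^esub> y) = f x \<cdot>\<^bsub>T\<^esub> f y)}"

definition hom_image :: "'a semigrp \<Rightarrow> 'b semigrp \<Rightarrow> bool" where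
  "hom_image S T \<longleftrightarrow> (\<exists>f\<in>semigrp_hom S T. f ` carrier S = carrier T)"

definition isomorphic :: "'a semigrp \<Rightarrow> 'b semigrp \<Rightarrow> bool" where
  "isomorphic S T \<longleftrightarrow> (\<exists>f\<in>semigrp_hom S T. bij_betw f (carrier S) (carrier T))"

definition direct_product :: "nat \<Rightarrow> (nat \<Rightarrow> 'a semigrp) \<Rightarrow> (nat \<Rightarrow> 'a) semigrp" where
  "direct_product n S = \<lparr>carrier = (\<Pi>\<^sub>E i\<in>{..<n}. carrier (S i)),
     sprod = (\<lambda>x y. \<lambda>i\<in>{..<n}. x i \<cdot>\<^bsub>S i\<^esub> y i)\<rparr>"

text \<open>Every finite semigroup is isomorphic to one whose carrier is a set of natural numbers,
  so classes of finite semigroups closed under isomorphism are represented by sets of such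
  semigroups. The product of members of a class has a different type; closure under products
  therefore means that every copy of the product on natural numbers is in the class. The empty
  product is the trivial semigroup.\<close>

definition pseudovariety :: "nat semigrp set \<Rightarrow> bool" where
  "pseudovariety V \<longleftrightarrow>
     (\<forall>S\<in>V. finite_semigrp S) \<and>
     (\<forall>S\<in>V. \<forall>T. subsemigrp T S \<longrightarrow> T \<in> V) \<and>
     (\<forall>S\<in>V. \<forall>T. semigrp T \<and> hom_image S T \<longrightarrow> T \<in> V) \<and>
     (\<forall>n S P. (\<forall>i<n. S i \<in> V) \<and> semigrp P \<and> isomorphic (direct_product n S) P \<longrightarrow> P \<in> V)"

definition pseudovariety_generated :: "nat semigrp set \<Rightarrow> nat semigrp set" ("\<langle>_\<rangle>") where
  "\<langle>C\<rangle> = \<Inter>{V. pseudovariety V \<and> C \<subseteq> V}"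

definition inverse_semigrp :: "'a semigrp \<Rightarrow> bool" where
  "inverse_semigrp S \<longleftrightarrow> semigrp S \<and>
     (\<forall>x\<in>carrier S. \<exists>!y. y \<in> carrier S \<and> x \<cdot>\<^bsub>S\<^esub> y \<cdot>\<^bsub>S\<^esub> x = x \<and> y \<cdot>\<^bsub>S\<^esub> x \<cdot>\<^bsub>S\<^esub> y = y)"

text \<open>The identity of a subgroup may be any idempotent of the semigroup.\<close>

definition is_subgroup :: "'a set \<Rightarrow> 'a semigrp \<Rightarrow> bool" where
  "is_subgroup H S \<longleftrightarrow> H \<subseteq> carrier S \<and>
     (\<exists>e. group \<lparr>carrier = H, monoid.mult = sprod S, one = e\<rparr>)"

definition aperiodic :: "'a semigrp \<Rightarrow> bool" where
  "aperiodic S \<longleftrightarrow> (\<forall>H. is_subgroup H S \<longrightarrow> (\<exists>e. H = {e}))"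

definition has_identity :: "'a semigrp \<Rightarrow> bool" where
  "has_identity S \<longleftrightarrow>
     (\<exists>e\<in>carrier S. \<forall>x\<in>carrier S. e \<cdot>\<^bsub>S\<^esub> x = x \<and> x \<cdot>\<^bsub>S\<^esub> e = x)"

text \<open>\<open>S\<^sup>1\<close>, with \<open>S\<close> embedded by \<^const>\<open>Some\<close> and \<^const>\<open>None\<close> as the adjoined identity.\<close>

definition adjoin_one :: "'a semigrp \<Rightarrow> 'a option semigrp" where
  "adjoin_one S = \<lparr>carrier = Some ` carrier S \<union> (if has_identity S then {} else {None}),
     sprod = (\<lambda>x y. case x of None \<Rightarrow> y | Some a \<Rightarrow>
       (case y of None \<Rightarrow> x | Some b \<Rightarrow> Some (a \<cdot>\<^bsub>S\<^esub> b)))\<rparr>"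

fun malcev_lambda :: "'a semigrp \<Rightarrow> 'a \<Rightarrow> 'a \<Rightarrow> (nat \<Rightarrow> 'a) \<Rightarrow> nat \<Rightarrow> 'a"
  and malcev_rho :: "'a semigrp \<Rightarrow> 'a \<Rightarrow> 'a \<Rightarrow> (nat \<Rightarrow> 'a) \<Rightarrow> nat \<Rightarrow> 'a" where
  "malcev_lambda M x y z 0 = x"
| "malcev_rho M x y z 0 = y"
| "malcev_lambda M x y z (Suc n) =
     malcev_lambda M x y z n \<cdot>\<^bsub>M\<^esub> z (Suc n) \<cdot>\<^bsub>M\<^esub> malcev_rho M x y z n"
| "malcev_rho M x y z (Suc n) =
     malcev_rho M x y z n \<cdot>\<^bsub>M\<^esub> z (Suc n) \<cdot>\<^bsub>M\<^esub> malcev_lambda M x y z n"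

definition malcev_nilpotent :: "'a semigrp \<Rightarrow> bool" where
  "malcev_nilpotent S \<longleftrightarrow> (\<exists>n. \<forall>a\<in>carrier S. \<forall>b\<in>carrier S. \<forall>c.
     (\<forall>i\<in>{1..n}. c i \<in> carrier (adjoin_one S)) \<longrightarrow>
     malcev_lambda (adjoin_one S) (Some a) (Some b) c n =
     malcev_rho (adjoin_one S) (Some a) (Some b) c n)"

definition Inv :: "nat semigrp set" where
  "Inv = {S. finite_semigrp S \<and> inverse_semigrp S}"

definition Aper :: "nat semigrp set" where
  "Aper = {S. finite_semigrp S \<and> aperiodic S}"

definition MN :: "nat semigrp set" where
  "MN = {S. finite_semigrp S \<and> malcev_nilpotent S}"

end

(* The semigroup of rank-at-most-one partial bijections of three points together with the two
   partial bijections z: 0 -> 1, 2 -> 0 and w: 2 -> 1, 0 -> 0 embeds in a finite inverse semigroup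
   and is aperiodic, but with z and w inserted alternately the Mal'cev words of 0 -> 0 and 1 -> 2
   return to their initial values after two steps.  Conversely, commuting idempotents define a
   pseudovariety containing all finite inverse semigroups, whereas the semigroup generated by two
   idempotents e, f with efe = fef = 0 is aperiodic and Mal'cev nilpotent although ef and fe
   differ. *)

theory Submission
  imports Defs "HOL-Library.Countable" "HOL-Library.Numeral_Type"
begin

section \<open>Idempotents\<close>

definition commuting_idempotents :: "'a semigrp \<Rightarrow> bool" where
  "commuting_idempotents S \<longleftrightarrow> (\<forall>e\<in>carrier S. \<forall>f\<in>carrier S.
     e \<cdot>\<^bsub>S\<^esub> e = e \<longrightarrow> f \<cdot>\<^bsub>S\<^esub> f = f \<longrightarrow> e \<cdot>\<^bsub>S\<^esub> f = f \<cdot>\<^bsub>S\<^esub> e)"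

lemma commuting_idempotentsD:
  assumes "commuting_idempotents S" "e \<in> carrier S" "f \<in> carrier S"
    "e \<cdot>\<^bsub>S\<^esub> e = e" "f \<cdot>\<^bsub>S\<^esub> f = f"
  shows "e \<cdot>\<^bsub>S\<^esub> f = f \<cdot>\<^bsub>S\<^esub> e"
  using assms by (simp add: commuting_idempotents_def)

text \<open>Uniqueness of inverses is used three times: twice to see that a product of two
  idempotents is idempotent, and once to identify \<open>ef\<close> with \<open>fe\<close>.\<close>

lemma (in semigrp) inverse_imp_commuting_idempotents:
  assumes inv: "\<forall>x\<in>carrier S. \<exists>!y. y \<in> carrier S \<and> x \<cdot> y \<cdot> x = x \<and> y \<cdot> x \<cdot> y = y"
    and e: "e \<in> carrier S" "e \<cdot> e = e" and f: "f \<in> carrier S" "f \<cdot> f = f"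
  shows "e \<cdot> f = f \<cdot> e"
proof -
  have uniq: "y = y'" if "x \<in> carrier S" "y \<in> carrier S" "y' \<in> carrier S"
      "x \<cdot> y \<cdot> x = x" "y \<cdot> x \<cdot> y = y" "x \<cdot> y' \<cdot> x = x" "y' \<cdot> x \<cdot> y' = y'" for x y y'
    using inv that by blast
  have idem: "e \<cdot> f \<cdot> (e \<cdot> f) = e \<cdot> f"
    if e: "e \<in> carrier S" "e \<cdot> e = e" and f: "f \<in> carrier S" "f \<cdot> f = f" for e f
  proof -
    have e': "e \<cdot> (e \<cdot> u) = e \<cdot> u" and f': "f \<cdot> (f \<cdot> u) = f \<cdot> u" if "u \<in> carrier S" for u
      using e f that by (metis assoc)+
    obtain x where x: "x \<in> carrier S" "e \<cdot> f \<cdot> x \<cdot> (e \<cdot> f) = e \<cdot> f" "x \<cdot> (e \<cdot> f) \<cdot> x = x"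
      using inv e f closed by meson
    have xs: "e \<cdot> (f \<cdot> (x \<cdot> (e \<cdot> f))) = e \<cdot> f" "x \<cdot> (e \<cdot> (f \<cdot> x)) = x"
      using x e f by (simp_all add: assoc closed)
    have xs': "x \<cdot> (e \<cdot> (f \<cdot> (x \<cdot> u))) = x \<cdot> u" if "u \<in> carrier S" for u
      using arg_cong[OF xs(2), of "\<lambda>v. v \<cdot> u"] that x(1) e f by (simp add: assoc closed)
    \<comment> \<open>Both \<open>x\<close> and \<open>fxe\<close> are inverses of
      \<open>ef\<close>. The form \<open>fxe\<close> makes \<open>x\<close> idempotent, since
      \<open>x(ef)x = x\<close> collapses its square.\<close>
    have fxe: "f \<cdot> (x \<cdot> e) = x"
      by (rule uniq[of "e \<cdot> f"]) (use x e f xs xs' e' f' in \<open>simp_all add: assoc closed\<close>)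
    have "x \<cdot> x = f \<cdot> (x \<cdot> e) \<cdot> (f \<cdot> (x \<cdot> e))"
      by (simp only: fxe)
    also have "\<dots> = f \<cdot> (x \<cdot> e)"
      using x(1) e f xs' by (simp add: assoc closed)
    finally have xx: "x \<cdot> x = x"
      by (simp only: fxe)
    \<comment> \<open>An idempotent \<open>x\<close> is its own inverse, and \<open>ef\<close> is an
      inverse of \<open>x\<close> by the choice of \<open>x\<close>.\<close>
    have "e \<cdot> f = x"
      by (rule uniq[of x]) (use x e f xx in \<open>simp_all add: closed\<close>)
    then show ?thesis
      using xx by simp
  qed
  have ef: "e \<cdot> (f \<cdot> (e \<cdot> f)) = e \<cdot> f" and fe: "f \<cdot> (e \<cdot> (f \<cdot> e)) = f \<cdot> e"
    using idem[of e f] idem[of f e] e f by (simp_all add: assoc closed)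
  have e': "e \<cdot> (e \<cdot> u) = e \<cdot> u" and f': "f \<cdot> (f \<cdot> u) = f \<cdot> u" if "u \<in> carrier S" for u
    using e f that by (metis assoc)+
  \<comment> \<open>Since \<open>ef\<close> and \<open>fe\<close> are idempotent, each of them is an
    inverse of \<open>ef\<close>.\<close>
  show ?thesis
    by (rule uniq[of "e \<cdot> f"]) (use e f ef fe e' f' in \<open>simp_all add: assoc closed\<close>)
qed

section \<open>Lifting idempotents along surjections of finite semigroups\<close>

text \<open>The finite case of the Ellis--Numakura argument: in a minimal closed subset \<open>A\<close> both \<open>Aa\<close>
  and the left stabilizer of \<open>a\<close> are all of \<open>A\<close>.\<close>

lemma (in semigrp) finite_closed_subset_has_idempotent:
  assumes "finite B" "B \<noteq> {}" "B \<subseteq> carrier S" "\<forall>x\<in>B. \<forall>y\<in>B. x \<cdot> y \<in> B"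
  obtains e where "e \<in> B" "e \<cdot> e = e"
proof -
  let ?P = "\<lambda>A. A \<noteq> {} \<and> A \<subseteq> B \<and> (\<forall>x\<in>A. \<forall>y\<in>A. x \<cdot> y \<in> A)"
  have "finite {A. ?P A}" "{A. ?P A} \<noteq> {}"
    using assms by (auto intro: finite_subset[of _ "Pow B"])
  then obtain A where "A \<in> {A. ?P A}" and min': "\<forall>C\<in>{A. ?P A}. C \<subseteq> A \<longrightarrow> A = C"
    using finite_has_minimal[of "{A. ?P A}"] by meson
  then have A: "?P A"
    by simp
  have min: "C = A" if "?P C" "C \<subseteq> A" for C
    using min'[rule_format, of C] that by simp
  from A obtain a where a: "a \<in> A"
    by blast
  have AS: "x \<in> carrier S" if "x \<in> A" for x
    using A assms that by blast
  have "(\<lambda>x. x \<cdot> a) ` A = A"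
  proof (rule min)
    have "(x \<cdot> a) \<cdot> (y \<cdot> a) \<in> (\<lambda>x. x \<cdot> a) ` A" if "x \<in> A" "y \<in> A" for x y
    proof (rule image_eqI)
      show "(x \<cdot> a) \<cdot> (y \<cdot> a) = ((x \<cdot> a) \<cdot> y) \<cdot> a"
        using that a AS by (simp add: assoc closed)
    qed (use A a that in blast)
    then show "?P ((\<lambda>x. x \<cdot> a) ` A)"
      using A a by blast
  qed (use A a in blast)
  \<comment> \<open>The element \<open>a\<close> itself lies in \<open>Aa = A\<close>; the resulting
    \<open>b\<close> shows that the left stabilizer of \<open>a\<close> is nonempty.\<close>
  then obtain b where b: "b \<in> A" "b \<cdot> a = a"
    using a by (metis imageE)
  have "{x\<in>A. x \<cdot> a = a} = A"
  proof (rule min)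
    show "?P {x\<in>A. x \<cdot> a = a}"
      using A a b AS by (auto simp: assoc)
  qed blast
  then have "a \<cdot> a = a"
    using a by blast
  then show thesis
    using that a A by blast
qed

text \<open>The fibre over \<open>e\<close> is finite, nonempty by surjectivity, and closed under
  products because \<open>e\<close> is idempotent; hence it contains an idempotent.\<close>

lemma idempotent_lift:
  assumes "finite_semigrp S" "h \<in> semigrp_hom S T" "h ` carrier S = carrier T"
    and e: "e \<in> carrier T" "e \<cdot>\<^bsub>T\<^esub> e = e"
  obtains d where "d \<in> carrier S" "d \<cdot>\<^bsub>S\<^esub> d = d" "h d = e"
proof -
  interpret semigrp S
    using assms by (simp add: finite_semigrp_def)
  let ?B = "{x \<in> carrier S. h x = e}"
  have "finite ?B" "?B \<noteq> {}" "?B \<subseteq> carrier S"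
    using assms by (auto simp: finite_semigrp_def simp flip: assms(3))
  moreover have "\<forall>x\<in>?B. \<forall>y\<in>?B. x \<cdot>\<^bsub>S\<^esub> y \<in> ?B"
    using assms by (auto simp: semigrp_hom_def closed)
  ultimately show thesis
    using finite_closed_subset_has_idempotent[of ?B] that by blast
qed

text \<open>Two idempotents of the image lift to idempotents of \<open>S\<close>. These commute, and
  \<open>h\<close> carries the equation over to \<open>T\<close>.\<close>

lemma commuting_idempotents_hom_image:
  assumes S: "finite_semigrp S" "commuting_idempotents S" and "hom_image S T"
  shows "commuting_idempotents T"
  unfolding commuting_idempotents_def
proof (intro ballI impI)
  obtain h where h: "h \<in> semigrp_hom S T" "h ` carrier S = carrier T"
    using assms by (auto simp: hom_image_def)
  fix e f
  assume ef: "e \<in> carrier T" "f \<in> carrier T" "e \<cdot>\<^bsub>T\<^esub> e = e" "f \<cdot>\<^bsub>T\<^esub> f = f"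
  obtain d where d: "d \<in> carrier S" "d \<cdot>\<^bsub>S\<^esub> d = d" "h d = e"
    using idempotent_lift[OF S(1) h] ef by metis
  obtain g where g: "g \<in> carrier S" "g \<cdot>\<^bsub>S\<^esub> g = g" "h g = f"
    using idempotent_lift[OF S(1) h] ef by metis
  have "h (d \<cdot>\<^bsub>S\<^esub> g) = h (g \<cdot>\<^bsub>S\<^esub> d)"
    using commuting_idempotentsD[OF S(2)] d g by simp
  then show "e \<cdot>\<^bsub>T\<^esub> f = f \<cdot>\<^bsub>T\<^esub> e"
    using h d g by (simp add: semigrp_hom_def)
qed

section \<open>The pseudovariety of finite semigroups with commuting idempotents\<close>

lemma semigrp_direct_product:
  assumes "\<forall>i<n. semigrp (S i)"
  shows "semigrp (direct_product n S)"
proof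
  have "carrier (S i) \<noteq> {}" if "i < n" for i
    using assms that semigrp.nonempty by blast
  then show "carrier (direct_product n S) \<noteq> {}"
    by (simp add: direct_product_def PiE_eq_empty_iff)
qed (use assms in \<open>auto simp: direct_product_def PiE_iff semigrp.closed semigrp.assoc
       intro!: restrict_ext\<close>)

lemma commuting_idempotents_direct_product:
  assumes "\<forall>i<n. commuting_idempotents (S i)"
  shows "commuting_idempotents (direct_product n S)"
  unfolding commuting_idempotents_def
proof (intro ballI impI)
  fix e f
  assume ef: "e \<in> carrier (direct_product n S)" "f \<in> carrier (direct_product n S)"
    "e \<cdot>\<^bsub>direct_product n S\<^esub> e = e" "f \<cdot>\<^bsub>direct_product n S\<^esub> f = f"
  have "e i \<cdot>\<^bsub>S i\<^esub> f i = f i \<cdot>\<^bsub>S i\<^esub> e i" if "i < n" for i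
  proof (rule commuting_idempotentsD)
    show "e i \<cdot>\<^bsub>S i\<^esub> e i = e i" "f i \<cdot>\<^bsub>S i\<^esub> f i = f i"
      using fun_cong[OF ef(3), of i] fun_cong[OF ef(4), of i] that
      by (simp_all add: direct_product_def)
  qed (use assms ef that in \<open>auto simp: direct_product_def\<close>)
  then show "e \<cdot>\<^bsub>direct_product n S\<^esub> f = f \<cdot>\<^bsub>direct_product n S\<^esub> e"
    by (auto simp: direct_product_def intro!: restrict_ext)
qed

lemma isomorphic_imp_hom_image: "isomorphic S T \<Longrightarrow> hom_image S T"
  by (auto simp: isomorphic_def hom_image_def bij_betw_def)

lemma finite_hom_image: "finite (carrier S) \<Longrightarrow> hom_image S T \<Longrightarrow> finite (carrier T)"
  unfolding hom_image_def by (metis finite_imageI)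

lemma pseudovariety_commuting_idempotents:
  "pseudovariety {S. finite_semigrp S \<and> commuting_idempotents S}"
  unfolding pseudovariety_def mem_Collect_eq
proof (intro conjI ballI allI impI)
  fix S T :: "nat semigrp"
  assume S: "S \<in> {S. finite_semigrp S \<and> commuting_idempotents S}"
  then show "finite_semigrp S"
    by simp
  show "finite_semigrp T" "commuting_idempotents T" if "subsemigrp T S"
    using S that
    by (auto simp: finite_semigrp_def subsemigrp_def commuting_idempotents_def subset_iff
        intro: finite_subset)
  show "finite_semigrp T" "commuting_idempotents T" if "semigrp T \<and> hom_image S T"
    using S that finite_hom_image[of S T] commuting_idempotents_hom_image[of S T]
    by (auto simp: finite_semigrp_def)
next
  fix n and S :: "nat \<Rightarrow> nat semigrp" and P :: "nat semigrp"
  assume *: "(\<forall>i<n. finite_semigrp (S i) \<and> commuting_idempotents (S i)) \<and>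
    semigrp P \<and> isomorphic (direct_product n S) P"
  have "finite (carrier (direct_product n S))"
    using * by (auto simp: direct_product_def finite_semigrp_def intro!: finite_PiE)
  then have fin: "finite_semigrp (direct_product n S)"
    using * semigrp_direct_product[of n S] by (simp add: finite_semigrp_def)
  \<comment> \<open>A copy of the product is in particular a homomorphic image of it, so the closure
    under images also settles this case.\<close>
  have im: "hom_image (direct_product n S) P"
    using * isomorphic_imp_hom_image by blast
  then show "finite_semigrp P"
    using * fin finite_hom_image by (auto simp: finite_semigrp_def)
  show "commuting_idempotents P"
    using commuting_idempotents_hom_image[OF fin _ im] commuting_idempotents_direct_product *
    by blast
qed

text \<open>The semigroups with commuting idempotents form one of the pseudovarieties intersected in
  the definition of the generated one.\<close>

lemma generated_Inv_commuting_idempotents: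
  assumes "S \<in> \<langle>Inv\<rangle>"
  shows "commuting_idempotents S"
proof -
  have "commuting_idempotents T" if "inverse_semigrp T" for T :: "nat semigrp"
    using that semigrp.inverse_imp_commuting_idempotents[of T]
    by (simp add: inverse_semigrp_def commuting_idempotents_def)
  then have "Inv \<subseteq> {S. finite_semigrp S \<and> commuting_idempotents S}"
    by (auto simp: Inv_def)
  then show ?thesis
    using assms pseudovariety_commuting_idempotents unfolding pseudovariety_generated_def by blast
qed

section \<open>Aperiodicity and Mal'cev nilpotency\<close>

text \<open>Inside a subgroup, \<open>x^4 = x^3\<close> can be cancelled to make \<open>x\<close>
  the identity.\<close>

lemma aperiodicI:
  assumes pow: "\<forall>x\<in>carrier S. x \<cdot>\<^bsub>S\<^esub> x \<cdot>\<^bsub>S\<^esub> x \<cdot>\<^bsub>S\<^esub> x = x \<cdot>\<^bsub>S\<^esub> x \<cdot>\<^bsub>S\<^esub> x"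
  shows "aperiodic S"
  unfolding aperiodic_def
proof (intro allI impI)
  fix H
  assume "is_subgroup H S"
  then obtain e where H: "H \<subseteq> carrier S"
    and G: "group \<lparr>carrier = H, monoid.mult = sprod S, one = e\<rparr>" (is "group ?G")
    by (auto simp: is_subgroup_def)
  interpret group ?G
    by (fact G)
  have "x = e" if "x \<in> H" for x
    using bspec[OF pow, of x] H that m_closed[of x x] m_closed[of "x \<cdot>\<^bsub>S\<^esub> x" x]
      r_cancel_one'[of "x \<cdot>\<^bsub>S\<^esub> x \<cdot>\<^bsub>S\<^esub> x" x] l_cancel_one[of "x \<cdot>\<^bsub>S\<^esub> x \<cdot>\<^bsub>S\<^esub> x" x]
    by auto
  then show "\<exists>e. H = {e}"
    using one_closed by auto
qed

lemma adjoin_one_sprod [simp]: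
  "Some x \<cdot>\<^bsub>adjoin_one S\<^esub> Some y = Some (x \<cdot>\<^bsub>S\<^esub> y)"
  "None \<cdot>\<^bsub>adjoin_one S\<^esub> v = v"
  "u \<cdot>\<^bsub>adjoin_one S\<^esub> None = u"
  by (auto simp: adjoin_one_def split: option.splits)

lemma adjoin_one_carrierE:
  assumes "c \<in> carrier (adjoin_one S)"
  obtains "c = None" | z where "z \<in> carrier S" "c = Some z"
  using assms by (auto simp: adjoin_one_def split: if_splits)

text \<open>Inserting \<open>z\<close> sends the pair \<open>(a, b)\<close> to
  \<open>(p, q)\<close>, and inserting \<open>w\<close> sends it back, so the two Mal'cev words
  never meet.\<close>

lemma malcev_cycle_not_nilpotent:
  assumes S: "a \<in> carrier S" "b \<in> carrier S" "z \<in> carrier S" "w \<in> carrier S"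
    and "a \<noteq> b"
    and p: "a \<cdot>\<^bsub>S\<^esub> z \<cdot>\<^bsub>S\<^esub> b = p" and q: "b \<cdot>\<^bsub>S\<^esub> z \<cdot>\<^bsub>S\<^esub> a = q"
    and a: "p \<cdot>\<^bsub>S\<^esub> w \<cdot>\<^bsub>S\<^esub> q = a" and b: "q \<cdot>\<^bsub>S\<^esub> w \<cdot>\<^bsub>S\<^esub> p = b"
  shows "\<not> malcev_nilpotent S"
proof
  \<comment> \<open>The step from \<open>n\<close> to \<open>Suc n\<close> inserts entry
    \<open>Suc n\<close>: odd entries act on \<open>(a, b)\<close>, positive even ones on
    \<open>(p, q)\<close>.\<close>
  define c where "c = (\<lambda>i::nat. Some (if odd i then z else w))"
  have *: "malcev_lambda (adjoin_one S) (Some a) (Some b) c n = Some (if even n then a else p) \<and>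
    malcev_rho (adjoin_one S) (Some a) (Some b) c n = Some (if even n then b else q)" for n
    by (induction n) (auto simp: c_def p q a b)
  \<comment> \<open>If \<open>p = q\<close>, then \<open>pwq = qwp\<close>, that is,
    \<open>a = b\<close>.\<close>
  have "p \<noteq> q"
    using a b \<open>a \<noteq> b\<close> by auto
  moreover have "c i \<in> carrier (adjoin_one S)" for i
    using S by (auto simp: c_def adjoin_one_def)
  moreover assume "malcev_nilpotent S"
  ultimately obtain n where "malcev_lambda (adjoin_one S) (Some a) (Some b) c n =
      malcev_rho (adjoin_one S) (Some a) (Some b) c n"
    using S unfolding malcev_nilpotent_def by blast
  with \<open>p \<noteq> q\<close> \<open>a \<noteq> b\<close> show False
    by (auto simp: * split: if_splits)
qed

text \<open>Equal starting elements give equal words throughout. From distinct ones, the first step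
  puts both words into \<open>N\<close> and the second makes both equal to \<open>c\<close>. Each
  step has two hypotheses, as the inserted element may be the adjoined identity.\<close>

lemma malcev_nilpotentI:
  fixes S :: "'a semigrp"
  assumes N1: "\<forall>x\<in>carrier S. \<forall>y\<in>carrier S. x \<noteq> y \<longrightarrow> x \<cdot>\<^bsub>S\<^esub> y \<in> N"
    and N2: "\<forall>x\<in>carrier S. \<forall>z\<in>carrier S. \<forall>y\<in>carrier S. x \<noteq> y \<longrightarrow> x \<cdot>\<^bsub>S\<^esub> z \<cdot>\<^bsub>S\<^esub> y \<in> N"
    and o1: "\<forall>x\<in>N. \<forall>y\<in>N. x \<cdot>\<^bsub>S\<^esub> y = c"
    and o2: "\<forall>x\<in>N. \<forall>z\<in>carrier S. \<forall>y\<in>N. x \<cdot>\<^bsub>S\<^esub> z \<cdot>\<^bsub>S\<^esub> y = c"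
  shows "malcev_nilpotent S"
  unfolding malcev_nilpotent_def
proof (intro exI[of _ 2] ballI allI impI)
  fix a b and d :: "nat \<Rightarrow> 'a option"
  assume ab: "a \<in> carrier S" "b \<in> carrier S"
    and d: "\<forall>i\<in>{1..2}. d i \<in> carrier (adjoin_one S)"
  let ?l = "malcev_lambda (adjoin_one S) (Some a) (Some b) d"
  let ?r = "malcev_rho (adjoin_one S) (Some a) (Some b) d"
  have ds: "d (Suc 0) \<in> carrier (adjoin_one S)" "d (Suc (Suc 0)) \<in> carrier (adjoin_one S)"
    using d by auto
  show "?l 2 = ?r 2"
  proof (cases "a = b")
    case True
    then show ?thesis
      by (simp add: numeral_2_eq_2)
  next
    case False
    obtain x y where xy: "x \<in> N" "y \<in> N" "?l 1 = Some x" "?r 1 = Some y"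
      using ds(1)
    proof (cases rule: adjoin_one_carrierE)
      case 1
      then show thesis
        using that[of "a \<cdot>\<^bsub>S\<^esub> b" "b \<cdot>\<^bsub>S\<^esub> a"] ab False by (simp add: N1)
    next
      case (2 z)
      then show thesis
        using that[of "a \<cdot>\<^bsub>S\<^esub> z \<cdot>\<^bsub>S\<^esub> b" "b \<cdot>\<^bsub>S\<^esub> z \<cdot>\<^bsub>S\<^esub> a"] ab False by (simp add: N2)
    qed
    from ds(2) show ?thesis
      by (cases rule: adjoin_one_carrierE)
        (use xy in \<open>simp_all add: numeral_2_eq_2 o1 o2\<close>)
  qed
qed

section \<open>A non-nilpotent semigroup of partial bijections\<close>

text \<open>The classes \<open>Inv\<close>, \<open>Aper\<close> and \<open>MN\<close> live on the
  type \<open>nat\<close>; the copy allows a witness to be built on any countable type.\<close>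

definition nat_copy :: "'a::countable semigrp \<Rightarrow> nat semigrp" where
  "nat_copy S = \<lparr>carrier = to_nat ` carrier S,
     sprod = (\<lambda>x y. to_nat (from_nat x \<cdot>\<^bsub>S\<^esub> from_nat y))\<rparr>"

lemma semigrp_nat_copy: "semigrp S \<Longrightarrow> semigrp (nat_copy S)"
  by unfold_locales (auto simp: nat_copy_def semigrp.nonempty semigrp.closed semigrp.assoc)

lemma inverse_semigrp_nat_copy: "inverse_semigrp S \<Longrightarrow> inverse_semigrp (nat_copy S)"
  unfolding inverse_semigrp_def
proof (intro conjI ballI; elim conjE)
  fix x
  assume inv: "\<forall>x\<in>carrier S. \<exists>!y. y \<in> carrier S \<and> x \<cdot>\<^bsub>S\<^esub> y \<cdot>\<^bsub>S\<^esub> x = x \<and> y \<cdot>\<^bsub>S\<^esub> x \<cdot>\<^bsub>S\<^esub> y = y"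
    and "x \<in> carrier (nat_copy S)"
  then obtain u where u: "x = to_nat u" "u \<in> carrier S"
    by (auto simp: nat_copy_def)
  then obtain v where v: "v \<in> carrier S" "u \<cdot>\<^bsub>S\<^esub> v \<cdot>\<^bsub>S\<^esub> u = u" "v \<cdot>\<^bsub>S\<^esub> u \<cdot>\<^bsub>S\<^esub> v = v"
    and uniq: "\<And>y. y \<in> carrier S \<Longrightarrow> u \<cdot>\<^bsub>S\<^esub> y \<cdot>\<^bsub>S\<^esub> u = u \<Longrightarrow> y \<cdot>\<^bsub>S\<^esub> u \<cdot>\<^bsub>S\<^esub> y = y \<Longrightarrow> y = v"
    using inv by meson
  show "\<exists>!y. y \<in> carrier (nat_copy S) \<and> x \<cdot>\<^bsub>nat_copy S\<^esub> y \<cdot>\<^bsub>nat_copy S\<^esub> x = x \<and>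
      y \<cdot>\<^bsub>nat_copy S\<^esub> x \<cdot>\<^bsub>nat_copy S\<^esub> y = y"
  proof (rule ex1I[of _ "to_nat v"])
    fix y
    assume y: "y \<in> carrier (nat_copy S) \<and> x \<cdot>\<^bsub>nat_copy S\<^esub> y \<cdot>\<^bsub>nat_copy S\<^esub> x = x \<and>
      y \<cdot>\<^bsub>nat_copy S\<^esub> x \<cdot>\<^bsub>nat_copy S\<^esub> y = y"
    then obtain y' where "y = to_nat y'" "y' \<in> carrier S"
      by (auto simp: nat_copy_def)
    then show "y = to_nat v"
      using y uniq[of y'] by (simp add: nat_copy_def u)
  qed (use v in \<open>simp add: nat_copy_def u\<close>)
qed (simp add: semigrp_nat_copy)

lemma subsemigrp_nat_copy: "subsemigrp T S \<Longrightarrow> subsemigrp (nat_copy T) (nat_copy S)"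
  using semigrp_nat_copy[of T] by (auto simp: subsemigrp_def nat_copy_def)

text \<open>Every pseudovariety containing \<open>Inv\<close> contains the copy of \<open>S\<close>,
  hence also its subsemigroup, the copy of \<open>T\<close>.\<close>

lemma nat_copy_in_generated_Inv:
  assumes "inverse_semigrp S" "finite (carrier S)" "subsemigrp T S"
  shows "nat_copy T \<in> \<langle>Inv\<rangle>"
proof -
  have "finite (carrier (nat_copy S))"
    using assms by (simp add: nat_copy_def)
  then have "nat_copy S \<in> Inv"
    using inverse_semigrp_nat_copy[OF assms(1)]
    by (simp add: Inv_def finite_semigrp_def inverse_semigrp_def)
  then show ?thesis
    using subsemigrp_nat_copy[OF assms(3)]
    unfolding pseudovariety_generated_def pseudovariety_def by blast
qed

section \<open>The symmetric inverse monoid\<close>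

text \<open>Partial bijections are encoded as relations, and \<open>O\<close> composes them from
  left to right.\<close>

definition sym_inv :: "'a rel semigrp" where
  "sym_inv = \<lparr>carrier = {r. single_valued r \<and> single_valued (r\<inverse>)}, sprod = (O)\<rparr>"

lemma semigrp_relcomp:
  assumes "A \<noteq> {}" "\<And>r s. r \<in> A \<Longrightarrow> s \<in> A \<Longrightarrow> r O s \<in> A"
  shows "semigrp \<lparr>carrier = A, sprod = (O)\<rparr>"
  by unfold_locales (use assms in \<open>simp_all add: O_assoc\<close>)

text \<open>A pair \<open>(x, y)\<close> of \<open>r\<close> factors through \<open>r\<close>,
  \<open>s\<close>, \<open>r\<close>. The two single-valuedness conditions force the middle pair to
  be \<open>(y, x)\<close>.\<close>

lemma converse_subset_of_regular:
  assumes "single_valued r" "single_valued (r\<inverse>)" "r O s O r = r"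
  shows "r\<inverse> \<subseteq> s"
proof clarify
  fix x y
  assume xy: "(x, y) \<in> r"
  then obtain u v where "(x, u) \<in> r" "(u, v) \<in> s" "(v, y) \<in> r"
    using assms(3) by blast
  moreover from this xy have "u = y" "v = x"
    using assms(1,2) by (auto simp: single_valued_def)
  ultimately show "(y, x) \<in> s"
    by simp
qed

lemma inverse_semigrp_sym_inv: "inverse_semigrp (sym_inv :: 'a rel semigrp)"
  unfolding inverse_semigrp_def
proof (intro conjI ballI)
  show "semigrp (sym_inv :: 'a rel semigrp)"
    unfolding sym_inv_def
  proof (rule semigrp_relcomp)
    have "{} \<in> {r :: 'a rel. single_valued r \<and> single_valued (r\<inverse>)}"
      by simp
    then show "{r :: 'a rel. single_valued r \<and> single_valued (r\<inverse>)} \<noteq> {}"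
      by blast
  qed (simp add: single_valued_relcomp converse_relcomp)
next
  fix r :: "'a rel"
  assume "r \<in> carrier sym_inv"
  then have r: "single_valued r" "single_valued (r\<inverse>)"
    by (simp_all add: sym_inv_def)
  show "\<exists>!s. s \<in> carrier sym_inv \<and> r \<cdot>\<^bsub>sym_inv\<^esub> s \<cdot>\<^bsub>sym_inv\<^esub> r = r \<and>
      s \<cdot>\<^bsub>sym_inv\<^esub> r \<cdot>\<^bsub>sym_inv\<^esub> s = s"
  proof (rule ex1I)
    have "r O r\<inverse> O r = r" "r\<inverse> O r O r\<inverse> = r\<inverse>"
      using r by (auto simp: single_valued_def)
    then show "r\<inverse> \<in> carrier sym_inv \<and> r \<cdot>\<^bsub>sym_inv\<^esub> r\<inverse> \<cdot>\<^bsub>sym_inv\<^esub> r = r \<and>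
        r\<inverse> \<cdot>\<^bsub>sym_inv\<^esub> r \<cdot>\<^bsub>sym_inv\<^esub> r\<inverse> = r\<inverse>"
      using r by (simp add: sym_inv_def O_assoc)
  next
    fix s
    assume "s \<in> carrier sym_inv \<and> r \<cdot>\<^bsub>sym_inv\<^esub> s \<cdot>\<^bsub>sym_inv\<^esub> r = r \<and>
        s \<cdot>\<^bsub>sym_inv\<^esub> r \<cdot>\<^bsub>sym_inv\<^esub> s = s"
    then have s: "single_valued s" "single_valued (s\<inverse>)" "r O s O r = r" "s O r O s = s"
      by (simp_all add: sym_inv_def O_assoc)
    \<comment> \<open>The second inclusion is the first with \<open>r\<close> and \<open>s\<close>
      exchanged; together they give \<open>s = r\<inverse>\<close>, so inverses are unique.\<close>
    then have "r\<inverse> \<subseteq> s" "s\<inverse> \<subseteq> r"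
      using converse_subset_of_regular r by metis+
    then show "s = r\<inverse>"
      by auto
  qed
qed

section \<open>Rank-one partial bijections of three points with two maps of rank two\<close>

definition zrel :: "3 rel" where "zrel = {(0, 1), (2, 0)}"
definition wrel :: "3 rel" where "wrel = {(2, 1), (0, 0)}"

definition cycle_semigrp :: "3 rel semigrp" where
  "cycle_semigrp = \<lparr>carrier = {{}, zrel, wrel} \<union> range (\<lambda>p. {p}), sprod = (O)\<rparr>"

lemma three_distinct: "(0::3) \<noteq> 1" "(0::3) \<noteq> 2" "(1::3) \<noteq> 2"
  by simp_all

text \<open>All four products have rank one, so adjoining \<open>zrel\<close> and
  \<open>wrel\<close> to the maps of rank at most one creates no further elements.\<close>

lemma zw_products:
  "zrel O zrel = {(2, 1)}" "zrel O wrel = {(2, 0)}"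
  "wrel O zrel = {(0, 1)}" "wrel O wrel = {(0, 0)}"
  using three_distinct by (auto simp: zrel_def wrel_def)

text \<open>Composition does not raise the rank: the single pair has at most one continuation under
  \<open>r\<close>, and at most one predecessor.\<close>

lemma singleton_relcomp:
  assumes "single_valued r" "single_valued (r\<inverse>)"
  shows "{(i, j)} O r \<in> {{}} \<union> range (\<lambda>p. {p})" "r O {(i, j)} \<in> {{}} \<union> range (\<lambda>p. {p})"
proof -
  show "{(i, j)} O r \<in> {{}} \<union> range (\<lambda>p. {p})"
  proof (cases "\<exists>k. (j, k) \<in> r")
    case True
    then obtain k where "(j, k) \<in> r"
      by blast
    then have "{(i, j)} O r = {(i, k)}"
      using assms by (auto simp: single_valued_def)
    then show ?thesis
      by simp
  qed auto
  show "r O {(i, j)} \<in> {{}} \<union> range (\<lambda>p. {p})"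
  proof (cases "\<exists>k. (k, i) \<in> r")
    case True
    then obtain k where "(k, i) \<in> r"
      by blast
    then have "r O {(i, j)} = {(k, j)}"
      using assms by (auto simp: single_valued_def)
    then show ?thesis
      by simp
  qed auto
qed

lemma zw_single_valued:
  "single_valued zrel" "single_valued (zrel\<inverse>)" "single_valued wrel" "single_valued (wrel\<inverse>)"
  using three_distinct by (auto simp: zrel_def wrel_def single_valued_def)

lemma subsemigrp_cycle_semigrp: "subsemigrp cycle_semigrp sym_inv"
proof -
  let ?R = "{{}, zrel, wrel} \<union> range (\<lambda>p. {p})"
  have sv: "single_valued r \<and> single_valued (r\<inverse>)" if "r \<in> ?R" for r
    using that zw_single_valued by (auto simp: single_valued_def)
  have "r O s \<in> ?R" if rs: "r \<in> ?R" "s \<in> ?R" for r s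
  proof -
    \<comment> \<open>Either a factor has rank one and bounds the rank of the product, or both
      factors are empty or of rank two and the product table applies.\<close>
    consider i j where "r = {(i, j)}" | i j where "s = {(i, j)}"
      | "r \<in> {{}, zrel, wrel}" "s \<in> {{}, zrel, wrel}"
      using rs by (metis UnE rangeE surj_pair)
    then show ?thesis
    proof cases
      case 1
      then show ?thesis
        using singleton_relcomp(1)[of s] sv[OF rs(2)] by blast
    next
      case 2
      then show ?thesis
        using singleton_relcomp(2)[of r] sv[OF rs(1)] by blast
    qed (auto simp: zw_products)
  qed
  then have "semigrp cycle_semigrp"
    unfolding cycle_semigrp_def by (intro semigrp_relcomp) auto
  then show ?thesis
    using sv by (auto simp: subsemigrp_def cycle_semigrp_def sym_inv_def)
qed

text \<open>A singleton is idempotent or has empty square; the cube of \<open>zrel\<close> is empty,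
  and the square of \<open>wrel\<close> is the idempotent \<open>{(0, 0)}\<close>.\<close>

lemma cycle_semigrp_pow:
  assumes "r \<in> carrier cycle_semigrp"
  shows "r O r O r O r = r O r O r"
proof -
  have "{(i, j)} O {(i, j)} O {(i, j)} O {(i, j)} = {(i, j)} O {(i, j)} O {(i, j)}" for i j :: 3
    by auto
  moreover have "zrel O zrel O zrel O zrel = zrel O zrel O zrel"
    "wrel O wrel O wrel O wrel = wrel O wrel O wrel"
    unfolding zw_products using three_distinct by (auto simp: zrel_def wrel_def)
  ultimately show ?thesis
    using assms unfolding cycle_semigrp_def partial_object.simps by (elim UnE insertE rangeE) auto
qed

lemma aperiodic_cycle_semigrp: "aperiodic (nat_copy cycle_semigrp)"
proof (rule aperiodicI, rule ballI)
  fix x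
  assume "x \<in> carrier (nat_copy cycle_semigrp)"
  then obtain r where "r \<in> carrier cycle_semigrp" "x = to_nat r"
    by (auto simp: nat_copy_def)
  then show "x \<cdot>\<^bsub>nat_copy cycle_semigrp\<^esub> x \<cdot>\<^bsub>nat_copy cycle_semigrp\<^esub> x \<cdot>\<^bsub>nat_copy cycle_semigrp\<^esub> x
      = x \<cdot>\<^bsub>nat_copy cycle_semigrp\<^esub> x \<cdot>\<^bsub>nat_copy cycle_semigrp\<^esub> x"
    using cycle_semigrp_pow[of r] by (simp add: nat_copy_def cycle_semigrp_def O_assoc)
qed

lemma not_malcev_nilpotent_cycle_semigrp: "\<not> malcev_nilpotent (nat_copy cycle_semigrp)"
proof -
  let ?c = "to_nat :: 3 rel \<Rightarrow> nat"
  \<comment> \<open>The map \<open>zrel\<close> links the target of each of \<open>0 -> 0\<close>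
    and \<open>1 -> 2\<close> to the source of the other, and \<open>wrel\<close> does the same for
    \<open>0 -> 2\<close> and \<open>1 -> 0\<close>.\<close>
  have "{(0, 0)} O zrel O {(1, 2)} = {(0, 2)}" "{(1, 2)} O zrel O {(0, 0)} = {(1, 0)}"
    "{(0, 2)} O wrel O {(1, 0)} = {(0, 0)}" "{(1, 0)} O wrel O {(0, 2)} = {(1, 2)}"
    by (auto simp: zrel_def wrel_def)
  moreover have "?c {(0, 0)} \<noteq> ?c {(1, 2)}"
    by simp
  ultimately show ?thesis
    by (intro malcev_cycle_not_nilpotent[of "?c {(0, 0)}" _ "?c {(1, 2)}" "?c zrel" "?c wrel"
          "?c {(0, 2)}" "?c {(1, 0)}"])
      (simp_all add: nat_copy_def cycle_semigrp_def O_assoc)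
qed

section \<open>A nilpotent semigroup with non-commuting idempotents\<close>

text \<open>The elements \<open>0, 1, 2, 3, 4\<close> stand for \<open>0, e, f, ef, fe\<close>.\<close>

definition ef_semigrp :: "nat semigrp" where
  "ef_semigrp = \<lparr>carrier = {0, 1, 2, 3, 4}, sprod = (\<lambda>x y.
     if (x, y) = (1, 1) then 1
     else if (x, y) = (2, 2) then 2
     else if (x, y) \<in> {(1, 2), (1, 3), (3, 2)} then 3
     else if (x, y) \<in> {(2, 1), (2, 4), (4, 1)} then 4
     else 0)\<rparr>"

lemma finite_semigrp_ef_semigrp: "finite_semigrp ef_semigrp"
proof -
  have "\<forall>x\<in>carrier ef_semigrp. \<forall>y\<in>carrier ef_semigrp. x \<cdot>\<^bsub>ef_semigrp\<^esub> y \<in> carrier ef_semigrp"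
    "\<forall>x\<in>carrier ef_semigrp. \<forall>y\<in>carrier ef_semigrp. \<forall>z\<in>carrier ef_semigrp.
      x \<cdot>\<^bsub>ef_semigrp\<^esub> y \<cdot>\<^bsub>ef_semigrp\<^esub> z = x \<cdot>\<^bsub>ef_semigrp\<^esub> (y \<cdot>\<^bsub>ef_semigrp\<^esub> z)"
    by (simp_all add: ef_semigrp_def)
  then have "semigrp ef_semigrp"
    by unfold_locales (simp add: ef_semigrp_def, blast+)
  then show ?thesis
    by (simp add: finite_semigrp_def ef_semigrp_def)
qed

lemma aperiodic_ef_semigrp: "aperiodic ef_semigrp"
  by (rule aperiodicI) (simp add: ef_semigrp_def)

text \<open>The set \<open>N\<close> is the ideal \<open>{0, ef, fe}\<close>. A product with
  distinct outer factors involves both \<open>e\<close> and \<open>f\<close> or is zero, so it lies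
  in \<open>N\<close>. A product with both outer factors in \<open>N\<close> contains
  \<open>efe\<close>, \<open>fef\<close> or \<open>0\<close>, so it vanishes.\<close>

lemma malcev_nilpotent_ef_semigrp: "malcev_nilpotent ef_semigrp"
  by (rule malcev_nilpotentI[where N = "{0, 3, 4}" and c = 0]) (simp_all add: ef_semigrp_def)

lemma not_commuting_idempotents_ef_semigrp: "\<not> commuting_idempotents ef_semigrp"
  using commuting_idempotentsD[of ef_semigrp 1 2] by (auto simp: ef_semigrp_def)

theorem mainTheorem8:
  "\<not> \<langle>Inv\<rangle> \<inter> Aper \<subseteq> MN \<inter> Aper \<and> \<not> MN \<inter> Aper \<subseteq> \<langle>Inv\<rangle> \<inter> Aper"
proof
  have "semigrp (nat_copy cycle_semigrp)" "finite (carrier (nat_copy cycle_semigrp))"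
    using subsemigrp_cycle_semigrp semigrp_nat_copy
    by (auto simp: subsemigrp_def nat_copy_def)
  \<comment> \<open>The symmetric inverse monoid used here is finite because the type
    \<open>3 rel\<close> is.\<close>
  then have "nat_copy cycle_semigrp \<in> \<langle>Inv\<rangle> \<inter> Aper"
    using nat_copy_in_generated_Inv[OF inverse_semigrp_sym_inv _ subsemigrp_cycle_semigrp]
      aperiodic_cycle_semigrp by (simp add: Aper_def finite_semigrp_def)
  then show "\<not> \<langle>Inv\<rangle> \<inter> Aper \<subseteq> MN \<inter> Aper"
    using not_malcev_nilpotent_cycle_semigrp by (auto simp: MN_def)
  have "ef_semigrp \<in> MN \<inter> Aper"
    by (simp add: MN_def Aper_def finite_semigrp_ef_semigrp aperiodic_ef_semigrp
        malcev_nilpotent_ef_semigrp)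
  then show "\<not> MN \<inter> Aper \<subseteq> \<langle>Inv\<rangle> \<inter> Aper"
    using generated_Inv_commuting_idempotents not_commuting_idempotents_ef_semigrp by blast
qed

end
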